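(* Let $X$ be a real vector space and let $f:X\to\overline{\mathbb{R}}$ be an $l$-proper function. (a) A convex function $g:X\to\overline{\mathbb{R}}$ is a minimal convex majorant of $f$ if and only if its epigraph $\mathrm{epi}\,g$ is a convex component of the epigraph $\mathrm{epi}\,f$. (b) The family $\Sigma^+(f)$ of all minimal convex majorants of $f$ is nonempty and, furthermore, for each convex majorant $q$ of $f$ there exists a minimal convex majorant $g\in\Sigma^+(f)$ such that $g(x)\le q(x)$ for all $x\in X$. (c) The function $f$ is represented in the form $$f(x)=\min_{g\in\Sigma^+(f)} g(x)\quad\text{for all } x\in X$$ (in particular the minimum is attained for every $x$).
   Context: $\overline{\mathbb{R}}=\mathbb{R}\cup\{\pm\infty\}$. For $f:X\to\overline{\mathbb{R}}$, $\mathrm{epi}\,f=\{(x,\alpha)\in X\times\mathbb{R}: f(x)\le\alpha\}$. The function $f$ is $l$-proper if $f(x)>-\infty$ for all $x\in X$ and $\mathrm{epi}\,f\ne\varnothing$. A function $g:X\to\overline{\mathbb{R}}$ is convex if it is $l$-proper and $\mathrm{epi}\,g$ is a convex subset of $X\times\mathbb{R}$. A convex majorant of $f$ is a convex function $g:X\to\overline{\mathbb{R}}$ with $f(x)\le g(x)$ for all $x\in X$. A minimal convex majorant of $f$ is a convex majorant $g$ of $f$ such that there is no convex majorant $\phi\neq g$ of $f$ with $\phi(x)\le g(x)$ for all $x\in X$. A convex component of a nonempty subset $Q$ of a real vector space is a maximal (with respect to inclusion) nonempty convex subset of $Q$. *)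

theory Defs
  imports "HOL-Analysis.Analysis"
begin

(* The library's epigraph is restricted to real-valued functions. *)
definition epi :: "('a::real_vector \<Rightarrow> ereal) \<Rightarrow> ('a \<times> real) set"
  where "epi f = {(x, \<alpha>). f x \<le> ereal \<alpha>}"

definition l_proper :: "('a::real_vector \<Rightarrow> ereal) \<Rightarrow> bool"
  where "l_proper f \<longleftrightarrow> (\<forall>x. f x > -\<infinity>) \<and> epi f \<noteq> {}"

(* Convexity includes l-properness, so the constant \<infinity> is not a convex function. *)
definition convex_fun :: "('a::real_vector \<Rightarrow> ereal) \<Rightarrow> bool"
  where "convex_fun g \<longleftrightarrow> l_proper g \<and> convex (epi g)"

definition convex_majorant :: "('a::real_vector \<Rightarrow> ereal) \<Rightarrow> ('a \<Rightarrow> ereal) \<Rightarrow> bool"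
  where "convex_majorant f g \<longleftrightarrow> convex_fun g \<and> (\<forall>x. f x \<le> g x)"

definition minimal_convex_majorant :: "('a::real_vector \<Rightarrow> ereal) \<Rightarrow> ('a \<Rightarrow> ereal) \<Rightarrow> bool"
  where "minimal_convex_majorant f g \<longleftrightarrow>
    convex_majorant f g \<and>
    \<not> (\<exists>\<phi>. convex_majorant f \<phi> \<and> \<phi> \<noteq> g \<and> (\<forall>x. \<phi> x \<le> g x))"

definition Sigma_plus :: "('a::real_vector \<Rightarrow> ereal) \<Rightarrow> ('a \<Rightarrow> ereal) set"
  where "Sigma_plus f = {g. minimal_convex_majorant f g}"

definition convex_component :: "'b::real_vector set \<Rightarrow> 'b set \<Rightarrow> bool"
  where "convex_component Q C \<longleftrightarrow>
    C \<noteq> {} \<and> convex C \<and> C \<subseteq> Q \<and>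
    (\<forall>D. D \<noteq> {} \<and> convex D \<and> D \<subseteq> Q \<and> C \<subseteq> D \<longrightarrow> D = C)"

(* m is the attained minimum of S; the library's Min is meant for finite sets only. *)
definition is_minimum :: "'b::linorder set \<Rightarrow> 'b \<Rightarrow> bool"
  where "is_minimum S m \<longleftrightarrow> m \<in> S \<and> (\<forall>y\<in>S. m \<le> y)"

end

theory Submission
  imports Defs
begin

text \<open>Convex majorants of \<open>f\<close> correspond, with order reversed, to those convex subsets of
\<open>epi f\<close> that are epigraphs. Any convex \<open>D \<subseteq> epi f\<close> lies in the epigraph of its lower
boundary function \<open>x \<mapsto> inf {\<alpha>. (x, \<alpha>) \<in> D}\<close>, which is again a convex majorant of \<open>f\<close>; hence
convex components of \<open>epi f\<close> are automatically epigraphs. Existence of minimal majorants is then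
Zorn's lemma for convex subsets of \<open>epi f\<close>, and the minimum in (c) is attained because the
function equal to \<open>f x\<close> at \<open>x\<close> and to \<open>\<infinity>\<close> elsewhere is a convex majorant.\<close>

text \<open>The infimum is taken in \<open>ereal\<close>: an empty fibre yields \<infinity>, and a
  fibre unbounded below yields -\<infinity>, so the function is total for every
  \<open>D\<close>.\<close>

definition lower_boundary :: "('a \<times> real) set \<Rightarrow> 'a \<Rightarrow> ereal"
  where "lower_boundary D x = (INF \<alpha>\<in>{\<alpha>. (x, \<alpha>) \<in> D}. ereal \<alpha>)"

lemma mem_epi [simp]: "(x, \<alpha>) \<in> epi f \<longleftrightarrow> f x \<le> ereal \<alpha>"
  by (simp add: epi_def)

text \<open>An extended real is the infimum of the reals above it, so real heights alone recover the
  pointwise order, even at infinite values.\<close>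

lemma epi_subset_iff: "epi g \<subseteq> epi f \<longleftrightarrow> (\<forall>x. f x \<le> g x)"
proof
  assume sub: "epi g \<subseteq> epi f"
  show "\<forall>x. f x \<le> g x"
  proof
    fix x
    show "f x \<le> g x"
    proof (rule ereal_le_real)
      fix z assume "g x \<le> ereal z"
      then show "f x \<le> ereal z"
        using sub by (metis mem_epi subsetD)
    qed
  qed
next
  assume "\<forall>x. f x \<le> g x"
  then show "epi g \<subseteq> epi f"
    by (auto simp: epi_def intro: order_trans)
qed

lemma epi_eq_iff: "epi f = epi g \<longleftrightarrow> f = g"
  by (auto simp: set_eq_subset epi_subset_iff fun_eq_iff intro: antisym)

lemma subset_epi_lower_boundary: "D \<subseteq> epi (lower_boundary D)"
  by (auto simp: lower_boundary_def intro: INF_lower)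

lemma le_lower_boundary: "D \<subseteq> epi f \<Longrightarrow> f x \<le> lower_boundary D x"
  by (auto simp: lower_boundary_def intro!: INF_greatest)

text \<open>The infimum need not be attained, hence the slack \<open>e\<close>. Bounding by a real
  \<open>a\<close> also covers the value -\<infinity>.\<close>

lemma lower_boundary_le_epsilon:
  assumes "lower_boundary D x \<le> ereal a" "e > 0"
  obtains b where "(x, b) \<in> D" "b < a + e"
proof -
  have "lower_boundary D x < ereal (a + e)"
    using assms by (meson ereal_less_eq(3) le_less_trans less_add_same_cancel1 less_ereal.simps(1))
  then show ?thesis
    using that by (auto simp: lower_boundary_def INF_less_iff)
qed

text \<open>Points of the epigraph are approximated from within \<open>D\<close> up to height error
  \<open>e\<close>. Convex combinations of the approximants stay in \<open>D\<close>, the weighted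
  errors add up to \<open>e\<close> because \<open>u + v = 1\<close>, and \<open>e\<close> is
  arbitrary.\<close>

lemma convex_epi_lower_boundary:
  fixes D :: "('a::real_vector \<times> real) set"
  assumes "convex D"
  shows "convex (epi (lower_boundary D))"
proof (rule convexI)
  fix p q :: "'a \<times> real" and u v :: real
  assume p: "p \<in> epi (lower_boundary D)" and q: "q \<in> epi (lower_boundary D)"
    and uv: "0 \<le> u" "0 \<le> v" "u + v = 1"
  obtain x a y b where [simp]: "p = (x, a)" "q = (y, b)"
    by (metis surj_pair)
  have "lower_boundary D (u *\<^sub>R x + v *\<^sub>R y) \<le> ereal (u * a + v * b) + ereal e"
    if "e > 0" for e
  proof -
    obtain a' where a': "(x, a') \<in> D" "a' < a + e"
      using lower_boundary_le_epsilon [of D x a e] p \<open>e > 0\<close> by auto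
    obtain b' where b': "(y, b') \<in> D" "b' < b + e"
      using lower_boundary_le_epsilon [of D y b e] q \<open>e > 0\<close> by auto
    have "(u *\<^sub>R x + v *\<^sub>R y, u * a' + v * b') \<in> D"
      using convexD [OF assms a'(1) b'(1) uv] by simp
    then have "lower_boundary D (u *\<^sub>R x + v *\<^sub>R y) \<le> ereal (u * a' + v * b')"
      using subset_epi_lower_boundary by (metis mem_epi subsetD)
    also have "\<dots> \<le> ereal (u * a + v * b + e)"
    proof -
      have "u * a' + v * b' \<le> u * (a + e) + v * (b + e)"
        using a' b' uv by (intro add_mono mult_left_mono) auto
      also have "\<dots> = u * a + v * b + (u + v) * e"
        by (simp add: distrib_left distrib_right)
      finally show ?thesis unfolding uv(3) by simp
    qed
    finally show ?thesis by simp
  qed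
  then have "lower_boundary D (u *\<^sub>R x + v *\<^sub>R y) \<le> ereal (u * a + v * b)"
    using ereal_le_epsilon2 by blast
  then show "u *\<^sub>R p + v *\<^sub>R q \<in> epi (lower_boundary D)"
    by simp
qed

text \<open>The lower bound \<open>f\<close> excludes the value -\<infinity>, and a point of
  \<open>D\<close> witnesses a nonempty epigraph.\<close>

lemma convex_majorant_lower_boundary:
  assumes "l_proper f" "convex D" "D \<noteq> {}" "D \<subseteq> epi f"
  shows "convex_majorant f (lower_boundary D)"
proof -
  have "-\<infinity> < lower_boundary D x" for x
    using assms(1) le_lower_boundary [OF assms(4)] by (metis l_proper_def less_le_trans)
  then show ?thesis
    using assms subset_epi_lower_boundary [of D] convex_epi_lower_boundary [of D]
      le_lower_boundary [OF assms(4)]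
    by (auto simp: convex_majorant_def convex_fun_def l_proper_def)
qed

lemma convex_component_exists:
  assumes "convex C" "C \<noteq> {}" "C \<subseteq> Q"
  obtains D where "convex_component Q D" "C \<subseteq> D"
proof -
  let ?A = "{D. convex D \<and> C \<subseteq> D \<and> D \<subseteq> Q}"
  have "\<exists>M\<in>?A. \<forall>X\<in>?A. M \<subseteq> X \<longrightarrow> X = M"
  proof (rule subset_Zorn_nonempty)
    show "?A \<noteq> {}" using assms by auto
  next
    fix K assume K: "K \<noteq> {}" "subset.chain ?A K"
    have "convex (\<Union>K)"
    proof (rule convexI)
      fix x y and u v :: real
      assume "x \<in> \<Union>K" "y \<in> \<Union>K" and uv: "0 \<le> u" "0 \<le> v" "u + v = 1"
      then obtain S T where "S \<in> K" "x \<in> S" "T \<in> K" "y \<in> T" by auto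
      moreover from this have "S \<subseteq> T \<or> T \<subseteq> S"
        using K(2) by (auto simp: subset_chain_def)
      ultimately obtain U where "U \<in> K" "x \<in> U" "y \<in> U" by blast
      \<comment> \<open>Both points lie in one member \<open>U\<close> of the chain, and
        \<open>U\<close> is convex.\<close>
      then show "u *\<^sub>R x + v *\<^sub>R y \<in> \<Union>K"
        using K(2) uv by (auto simp: subset_chain_def intro!: bexI [of _ U] convexD)
    qed
    moreover have "C \<subseteq> \<Union>K" "\<Union>K \<subseteq> Q"
      using K unfolding subset_chain_def by blast+
    ultimately show "\<Union>K \<in> ?A"
      by blast
  qed
  then obtain M where M: "M \<in> ?A" and max: "\<forall>X\<in>?A. M \<subseteq> X \<longrightarrow> X = M" ..
  \<comment> \<open>Maximality among supersets of \<open>C\<close> is maximality among all convex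
    subsets of \<open>Q\<close>, since a set containing \<open>M\<close> contains
    \<open>C\<close>.\<close>
  have "D = M" if "convex D" "D \<subseteq> Q" "M \<subseteq> D" for D
    using M that by (intro max [rule_format]) auto
  then have "convex_component Q M"
    using M assms(2) by (auto simp: convex_component_def)
  then show ?thesis using that M by blast
qed

lemma minimal_convex_majorant_iff_convex_component:
  assumes f: "l_proper f" and g: "convex_fun g"
  shows "minimal_convex_majorant f g \<longleftrightarrow> convex_component (epi f) (epi g)"
proof
  assume min: "minimal_convex_majorant f g"
  have "D = epi g" if D: "D \<noteq> {}" "convex D" "D \<subseteq> epi f" "epi g \<subseteq> D" for D
  proof -
    \<comment> \<open>Here \<open>D\<close> is squeezed between \<open>epi g\<close> and
      \<open>epi (lower_boundary D)\<close>; minimality of \<open>g\<close> makes the two ends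
      coincide.\<close>
    have "epi g \<subseteq> epi (lower_boundary D)"
      using D(4) subset_epi_lower_boundary by blast
    then have "lower_boundary D = g"
      using min convex_majorant_lower_boundary [OF f D(2,1,3)]
      by (auto simp: minimal_convex_majorant_def epi_subset_iff)
    then show ?thesis
      using D(4) subset_epi_lower_boundary by blast
  qed
  then show "convex_component (epi f) (epi g)"
    using g min
    by (auto simp: convex_component_def convex_fun_def l_proper_def epi_subset_iff
        minimal_convex_majorant_def convex_majorant_def)
next
  assume comp: "convex_component (epi f) (epi g)"
  have "\<phi> = g" if "convex_majorant f \<phi>" "\<forall>x. \<phi> x \<le> g x" for \<phi>
  proof -
    have "epi \<phi> = epi g"
      using that comp unfolding convex_component_def
      by (simp add: convex_majorant_def convex_fun_def l_proper_def epi_subset_iff)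
    then show ?thesis by (simp add: epi_eq_iff)
  qed
  then show "minimal_convex_majorant f g"
    using g comp
    by (auto simp: minimal_convex_majorant_def convex_majorant_def convex_component_def
        epi_subset_iff)
qed

lemma minimal_convex_majorant_below:
  assumes f: "l_proper f" and q: "convex_majorant f q"
  obtains g where "minimal_convex_majorant f g" "\<And>x. g x \<le> q x"
proof -
  have "convex (epi q)" "epi q \<noteq> {}" "epi q \<subseteq> epi f"
    using q by (auto simp: convex_majorant_def convex_fun_def l_proper_def epi_subset_iff)
  then obtain D where D: "convex_component (epi f) D" "epi q \<subseteq> D"
    by (rule convex_component_exists)
  let ?g = "lower_boundary D"
  have maj: "convex_majorant f ?g"
    using D f by (intro convex_majorant_lower_boundary) (auto simp: convex_component_def)
  then have g: "convex_fun ?g" "epi ?g \<subseteq> epi f"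
    by (auto simp: convex_majorant_def epi_subset_iff)
  \<comment> \<open>\<open>epi ?g\<close> is a convex subset of \<open>epi f\<close> containing
    \<open>D\<close>, so maximality of \<open>D\<close> forces equality.\<close>
  then have "epi ?g = D"
    using D(1) subset_epi_lower_boundary [of D]
    by (auto simp: convex_component_def convex_fun_def l_proper_def)
  then have "minimal_convex_majorant f ?g" "\<forall>x. ?g x \<le> q x"
    using D minimal_convex_majorant_iff_convex_component [OF f g(1)]
    by (simp_all flip: epi_subset_iff)
  then show ?thesis using that by blast
qed

text \<open>The epigraph is a vertical half-line over \<open>x\<close>. If \<open>f x\<close> were
  \<infinity>, the function would be constantly \<infinity> and not l-proper.\<close>

lemma convex_majorant_at_point:
  assumes "l_proper f" "f x < \<infinity>"
  shows "convex_majorant f (\<lambda>y. if y = x then f x else \<infinity>)"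
proof -
  obtain r where r: "f x = ereal r"
    using assms by (cases "f x") (auto simp: l_proper_def)
  have "epi (\<lambda>y. if y = x then f x else \<infinity>) = {x} \<times> {r..}"
    by (auto simp: epi_def r split: if_splits)
  then show ?thesis
    by (auto simp: convex_majorant_def convex_fun_def l_proper_def r intro!: convex_Times)
qed

theorem theorem3p2:
  fixes f :: "'a::real_vector \<Rightarrow> ereal"
  assumes "l_proper f"
  shows "(\<forall>g. convex_fun g \<longrightarrow>
            (minimal_convex_majorant f g \<longleftrightarrow> convex_component (epi f) (epi g)))
       \<and> (Sigma_plus f \<noteq> {} \<and>
          (\<forall>q. convex_majorant f q \<longrightarrow> (\<exists>g\<in>Sigma_plus f. \<forall>x. g x \<le> q x)))
       \<and> (\<forall>x. is_minimum ((\<lambda>g. g x) ` Sigma_plus f) (f x))"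
proof (intro conjI allI impI)
  fix g :: "'a \<Rightarrow> ereal" assume "convex_fun g"
  then show "minimal_convex_majorant f g \<longleftrightarrow> convex_component (epi f) (epi g)"
    using assms by (rule minimal_convex_majorant_iff_convex_component [rotated])
next
  show below: "\<exists>g\<in>Sigma_plus f. \<forall>x. g x \<le> q x" if "convex_majorant f q" for q
    using minimal_convex_majorant_below [OF assms that] by (auto simp: Sigma_plus_def)
  have at_point: "\<exists>g\<in>Sigma_plus f. g x \<le> f x" if "f x < \<infinity>" for x
    using below [OF convex_majorant_at_point [OF assms that]]
    by (auto dest!: spec [of _ x])
  obtain x0 \<alpha> where "f x0 \<le> ereal \<alpha>"
    using assms by (auto simp: l_proper_def epi_def)
  then have "f x0 < \<infinity>"
    by auto
  then show ne: "Sigma_plus f \<noteq> {}"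
    using at_point by blast
  have ge: "f x \<le> g x" if "g \<in> Sigma_plus f" for g x
    using that by (auto simp: Sigma_plus_def minimal_convex_majorant_def convex_majorant_def)
  fix x
  obtain g where "g \<in> Sigma_plus f" "g x \<le> f x"
    \<comment> \<open>Where \<open>f x\<close> is \<infinity>, any member of the nonempty family
      will do.\<close>
    using at_point [of x] ne by (cases "f x < \<infinity>") auto
  then have "f x \<in> (\<lambda>g. g x) ` Sigma_plus f"
    using ge [of g x] by (auto intro!: image_eqI [of _ _ g] antisym)
  then show "is_minimum ((\<lambda>g. g x) ` Sigma_plus f) (f x)"
    using ge by (auto simp: is_minimum_def)
qed

end
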